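(* $$\int_0^1 x\,\log\Gamma(x)\,\sin(2\pi x)\,dx=\frac{\gamma}{4\pi}.$$
   Context: $\Gamma$ is the gamma function and $\gamma$ is Euler's constant. *)

theory Defs
  imports "HOL-Analysis.Analysis"
begin

end

(*
  Write x sin(2 pi x) = sin(2 pi x)/2 + w(x) - 1/(2 pi) with w(x) = (x - 1/2) sin(2 pi x) + 1/(2 pi),
  which is symmetric about 1/2 and has mean zero.  The integral of log Gamma against w vanishes: by
  the reflection formula it reduces to the integral of log sin(pi x) against w, which is elementary.
  Raabe's integral of log Gamma is log(2 pi)/2, by Legendre duplication.  Finally, integrating by
  parts, the integral of log Gamma(x) sin(2 pi x) becomes that of psi(x) (1 - cos(2 pi x)); the
  limit psi(x) = lim (log n - sum_{k<n} 1/(x+k)) unwraps it into the integral of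
  (1 - cos(2 pi x))/x over [0,n], which is log n + gamma + log(2 pi) + o(1).
*)
theory Submission
  imports Defs
begin

section \<open>Calculus on closed intervals with singular endpoints\<close>

lemma integral_by_antiderivative:
  fixes F f :: "real \<Rightarrow> real"
  assumes "a \<le> b" "continuous_on {a..b} F"
    and "\<And>x. a < x \<Longrightarrow> x < b \<Longrightarrow> (F has_real_derivative f x) (at x)"
  shows "(f has_integral (F b - F a)) {a..b}"
  by (rule fundamental_theorem_of_calculus_interior)
     (use assms in \<open>auto simp: has_real_derivative_iff_has_vector_derivative\<close>)

text \<open>The primitives below are given by formulas that are singular at 0 but not at 1. Hence
  only a right-hand limit is required at 0, to be compared with whatever value the total functions
  of HOL take there.\<close>

lemma continuous_on_unit_interval:
  fixes f :: "real \<Rightarrow> real"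
  assumes "(f \<longlongrightarrow> f 0) (at_right 0)" "\<And>x. 0 < x \<Longrightarrow> x \<le> 1 \<Longrightarrow> isCont f x"
  shows "continuous_on {0..1} f"
proof -
  have "continuous (at x within {0..1}) f" if "x \<in> {0..1}" for x
  proof (cases "x = 0")
    case True
    then show ?thesis
      using assms(1) by (simp add: continuous_within at_within_Icc_at_right)
  next
    case False
    then show ?thesis
      using that assms(2)[of x] by (auto intro: continuous_at_imp_continuous_at_within)
  qed
  then show ?thesis
    by (simp add: continuous_on_eq_continuous_within)
qed

section \<open>The conjugate Dirichlet kernel and the cotangent\<close>

text \<open>Raising \<open>m\<close> by one adds \<open>sin a + sin (a + 2 * t)\<close> to the
  bracket, and \<open>sin t\<close> times this is \<open>cos t\<close> times a difference of
  cosines, so the sum telescopes. Giving the last frequency half weight is what leaves a pure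
  cotangent after division by \<open>sin t\<close>.\<close>

lemma conjugate_dirichlet_kernel:
  fixes t :: real
  shows "sin t * (2 * (\<Sum>j<m. sin (2 * real j * t)) + sin (2 * real m * t)) =
         cos t * (1 - cos (2 * real m * t))"
proof (induction m)
  case (Suc m)
  define a where "a = 2 * real m * t"
  have *: "2 * real (Suc m) * t = a + 2 * t"
    by (simp add: a_def algebra_simps)
  have "sin t * (sin a + sin (a + 2 * t)) = cos t * (cos a - cos (a + 2 * t))"
    unfolding sin_add cos_add cos_double sin_double
    using sin_cos_squared_add[of t] by algebra
  then show ?case
    using Suc unfolding * sum.lessThan_Suc a_def[symmetric]
    by (simp add: algebra_simps)
qed auto

text \<open>Only odd \<open>j\<close> contribute, each 2/j, and the odd reciprocals below 2n are all
  reciprocals up to 2n minus the even ones. The term for \<open>j = 0\<close> is 0/0, which is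
  0.\<close>

lemma sum_alternating_harm:
  "(\<Sum>j<2*n. (1 - cos (pi * real j)) / real j) = 2 * harm (2*n) - harm n"
proof (induction n)
  case (Suc n)
  have c: "cos (pi * real (2*n)) = 1" "cos (pi * real (Suc (2*n))) = -1"
    using cos_npi2 by (simp_all only: mult.commute) (simp_all add: cos_npi2 mult.commute)
  have "2 * Suc n = Suc (Suc (2*n))" by simp
  then show ?case
    using Suc c by (simp only: sum.lessThan_Suc harm_Suc) (simp add: divide_simps, simp add: algebra_simps)
qed (auto simp: harm_def)

text \<open>The kernel identity at t = pi u/2 with m = 2n makes the integrand a sine polynomial on
  the open interval. Its terms integrate to (1 - cos (pi j)) / (pi j), and the half-weight term runs
  over full periods and gives 0.\<close>

lemma has_integral_conjugate_kernel:
  "((\<lambda>u. pi/2 * cot (pi*u/2) * (1 - cos (2*pi*real n*u))) has_integral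
      (2 * harm (2*n) - harm n)) {0..1}"
proof -
  define F where "F = (\<lambda>u. pi/2 * (2 * (\<Sum>j<2*n. sin (real j * pi * u)) + sin (2*pi*real n*u)))"
  have s: "((\<lambda>u. sin (real j * pi * u)) has_integral (1 - cos (pi * real j)) / (pi * real j)) {0..1}" for j
  proof (cases "j = 0")
    case False
    have "((\<lambda>u. sin (real j * pi * u)) has_integral
             (- cos (real j * pi * 1) / (real j * pi) - (- cos (real j * pi * 0) / (real j * pi)))) {0..1}"
      by (rule integral_by_antiderivative)
         (use False in \<open>auto intro!: derivative_eq_intros continuous_intros\<close>)
    then show ?thesis by (simp add: field_simps diff_divide_distrib)
  qed auto
  have s': "((\<lambda>u. sin (2*pi*real n*u)) has_integral 0) {0..1}"
    using s[of "2*n"] cos_npi2[of "2*n"] by (simp add: mult_ac)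
  have "(F has_integral (pi/2 * (2 * (\<Sum>j<2*n. (1 - cos (pi * real j)) / (pi * real j)) + 0))) {0..1}"
    unfolding F_def
    by (intro has_integral_mult_right has_integral_add has_integral_sum s s') auto
  also have "pi/2 * (2 * (\<Sum>j<2*n. (1 - cos (pi * real j)) / (pi * real j)) + 0) =
     pi * (\<Sum>j<2*n. (1 - cos (pi * real j)) / (pi * real j))"
    by simp
  also have "\<dots> = (\<Sum>j<2*n. (1 - cos (pi * real j)) / real j)"
    unfolding sum_distrib_left by (intro sum.cong) auto
  finally have "(F has_integral (2 * harm (2*n) - harm n)) {0..1}"
    by (simp only: sum_alternating_harm)
  then show ?thesis
    unfolding box_real(2)[symmetric]
  proof (rule has_integral_spike_interior)
    fix u :: real assume "u \<in> box 0 1"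
    then have "sin (pi*u/2) > 0"
      by (intro sin_gt_zero) (auto simp: box_real)
    then show "pi/2 * cot (pi*u/2) * (1 - cos (2*pi*real n*u)) = F u"
      using conjugate_dirichlet_kernel[of "pi*u/2" "2*n"]
      by (simp add: F_def cot_def divide_simps) (simp add: mult_ac)
  qed
qed

text \<open>Comparing \<open>1/u\<close> with a cotangent turns \<open>(1 - cos (2*pi*n*u)) / u\<close> into a sine polynomial,
  whose integral is a harmonic sum, up to the monotone error below. At 0 both terms are junk zeros,
  which happens to be the right limit.\<close>

definition cot_gap :: "real \<Rightarrow> real" where
  "cot_gap u = 1/u - pi/2 * cot (pi*u/2)"

text \<open>Monotonicity is needed for the second mean value theorem. Away from 0 the derivative is
  nonnegative because sin z \<le> z. From the conventional value 0 at 0 the claim is cot t \<le>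
  1/t, which holds because sin t - t cos t increases from 0.\<close>

lemma cot_gap_mono:
  assumes "0 \<le> x" "x \<le> y" "y \<le> 1"
  shows "cot_gap x \<le> cot_gap y"
proof (cases "x = 0")
  case True
  show ?thesis
  proof (cases "y = 0")
    case False
    define t where "t = pi*y/2"
    have t: "0 < t" "t \<le> pi/2"
      using False assms pi_gt_zero by (auto simp: t_def field_simps)
    have "sin 0 - 0 * cos 0 \<le> sin t - t * cos t"
    proof (rule DERIV_nonneg_imp_nondecreasing[where f = "\<lambda>t. sin t - t * cos t"])
      fix s assume s: "0 \<le> s" "s \<le> t"
      have "((\<lambda>t. sin t - t * cos t) has_real_derivative s * sin s) (at s)"
        by (auto intro!: derivative_eq_intros)
      moreover have "s * sin s \<ge> 0"
        using s t by (intro mult_nonneg_nonneg sin_ge_zero) auto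
      ultimately show "\<exists>D. ((\<lambda>t. sin t - t * cos t) has_real_derivative D) (at s) \<and> 0 \<le> D"
        by blast
    qed (use t in auto)
    moreover have "sin t > 0"
      using t by (intro sin_gt_zero) auto
    ultimately have "cot t \<le> 1/t"
      using t by (simp add: cot_def field_simps)
    then have "pi/2 * cot t \<le> pi/2 * (1/t)"
      by (intro mult_left_mono) auto
    also have "pi/2 * (1/t) = 1/y"
      by (simp add: t_def)
    finally show ?thesis
      using True by (simp add: cot_gap_def t_def)
  qed (use True in auto)
next
  case False
  show ?thesis
  proof (rule DERIV_nonneg_imp_nondecreasing[where f = cot_gap])
    fix s assume s: "x \<le> s" "s \<le> y"
    have t: "0 < pi * s / 2" "pi * s / 2 < pi"
      using s assms False by (auto simp: field_simps)
    then have pos: "sin (pi * s / 2) > 0"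
      by (intro sin_gt_zero)
    have d: "(cot_gap has_real_derivative ((pi/2)^2 * inverse (sin (pi * s / 2) ^ 2) - 1/s^2)) (at s)"
      unfolding cot_gap_def[abs_def] using pos s assms False
      by (auto intro!: derivative_eq_intros DERIV_cot[THEN DERIV_chain2] simp: power2_eq_square field_simps)
    have "sin (pi * s / 2) \<le> pi * s / 2"
      using t by (intro sin_x_le_x) auto
    then have "sin (pi * s / 2) ^ 2 \<le> (pi * s / 2)^2"
      using pos by (intro power_mono) auto
    then have "0 \<le> (pi/2)^2 * inverse (sin (pi * s / 2) ^ 2) - 1/s^2"
      using pos s assms False by (simp add: field_simps)
    with d show "\<exists>D. (cot_gap has_real_derivative D) (at s) \<and> 0 \<le> D"
      by blast
  qed (use assms in auto)
qed

lemma has_integral_cot_gap: "(cot_gap has_integral ln (pi/2)) {0..1}"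
proof -
  \<comment> \<open>The value at 0 is the limit of log (u / sin (pi u/2)), so \<open>F\<close> is
    continuous there.\<close>
  define F where "F = (\<lambda>u::real. if u = 0 then ln (2/pi) else ln (u / sin (pi*u/2)))"
  have pos: "sin (pi*u/2) > 0" if "0 < u" "u \<le> 1" for u
    using that pi_gt_zero by (intro sin_gt_zero) (auto simp: field_simps)
  have D: "(F has_real_derivative cot_gap u) (at u)" if u: "0 < u" "u \<le> 1" for u
  proof (rule has_field_derivative_transform_within)
    show "((\<lambda>u. ln (u / sin (pi*u/2))) has_real_derivative cot_gap u) (at u)"
      using pos[OF u] u
      by (auto intro!: derivative_eq_intros simp: cot_gap_def cot_def field_simps power2_eq_square)
    show "0 < u" "u \<in> UNIV" using u by auto
    show "ln (v / sin (pi * v / 2)) = F v" if "v \<in> UNIV" "dist v u < u" for v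
      using that by (auto simp: F_def dist_norm)
  qed
  have "(cot_gap has_integral (F 1 - F 0)) {0..1}"
  proof (rule integral_by_antiderivative)
    show "continuous_on {0..1} F"
    proof (rule continuous_on_unit_interval)
      have "((\<lambda>u::real. ln (u / sin (pi*u/2))) \<longlongrightarrow> ln (2/pi)) (at_right 0)"
        by real_asymp
      then have "(F \<longlongrightarrow> ln (2/pi)) (at_right 0)"
        by (rule Lim_transform_eventually) (auto simp: F_def eventually_at_filter)
      then show "(F \<longlongrightarrow> F 0) (at_right 0)"
        by (simp add: F_def)
    qed (use D DERIV_isCont in blast)
  qed (use D in auto)
  moreover have "F 1 - F 0 = ln (pi/2)"
    by (simp add: F_def ln_div)
  ultimately show ?thesis by simp
qed

text \<open>A quantitative Riemann-Lebesgue estimate: the second mean value theorem moves the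
  monotone factor out of the integral, leaving integrals of a cosine of frequency n.\<close>

lemma integral_cot_gap_cos:
  assumes "n > 0"
  obtains e where "((\<lambda>u. cot_gap u * cos (2*pi*real n*u)) has_integral e) {0..1}"
    "\<bar>e\<bar> \<le> 1 / real n"
proof -
  have int: "((\<lambda>u. cos (2*pi*real n*u)) has_integral
      (sin (2*pi*real n*b) / (2*pi*real n) - sin (2*pi*real n*a) / (2*pi*real n))) {a..b}" if "a \<le> b" for a b
    by (rule integral_by_antiderivative)
       (use assms that in \<open>auto intro!: derivative_eq_intros continuous_intros\<close>)
  obtain c where c: "c \<in> {0..1}" and I: "((\<lambda>u. cot_gap u * cos (2*pi*real n*u)) has_integral
      (cot_gap 0 * integral {0..c} (\<lambda>u. cos (2*pi*real n*u)) +
       cot_gap 1 * integral {c..1} (\<lambda>u. cos (2*pi*real n*u)))) {0..1}"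
    using second_mean_value_theorem_full[of "\<lambda>u. cos (2*pi*real n*u)" 0 1 cot_gap]
      int[of 0 1] cot_gap_mono by (auto simp: integrable_on_def)
  \<comment> \<open>Here \<open>cot_gap 0 = 0\<close> by the division conventions and
    \<open>cot_gap 1 = 1\<close> since cot (pi/2) = 0; the sine at the upper limit 1
    vanishes.\<close>
  have e: "cot_gap 0 * integral {0..c} (\<lambda>u. cos (2*pi*real n*u)) +
       cot_gap 1 * integral {c..1} (\<lambda>u. cos (2*pi*real n*u)) = - sin (2*pi*real n*c) / (2*pi*real n)"
    using integral_unique[OF int[of c 1]] c sin_npi[of "2*n"]
    by (simp add: cot_gap_def cot_def mult_ac)
  have "\<bar>- sin (2*pi*real n*c) / (2*pi*real n)\<bar> \<le> 1 / (2*pi*real n)"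
    using assms by (simp add: divide_right_mono)
  also have "\<dots> \<le> 1 / real n"
    using assms pi_gt3 by (intro divide_left_mono) auto
  finally show ?thesis
    using that I unfolding e by blast
qed

section \<open>Asymptotics of the entire cosine integral Cin at 2 pi n\<close>

text \<open>Splitting 1/u into cotangent plus \<open>cot_gap\<close> gives three pieces: the
  harmonic sum, the plain integral log (pi/2) of the gap, and an oscillating remainder
  \<open>e\<close>.\<close>

lemma has_integral_scaled_Cin:
  assumes "n > 0"
  obtains e where "((\<lambda>u. (1 - cos (2*pi*real n*u)) / u) has_integral
      (2 * harm (2*n) - harm n + ln (pi/2) - e)) {0..1}" "\<bar>e\<bar> \<le> 1 / real n"
proof -
  obtain e where e: "((\<lambda>u. cot_gap u * cos (2*pi*real n*u)) has_integral e) {0..1}" "\<bar>e\<bar> \<le> 1 / real n"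
    using integral_cot_gap_cos[OF assms] .
  have "((\<lambda>u. pi/2 * cot (pi*u/2) * (1 - cos (2*pi*real n*u)) + cot_gap u
          - cot_gap u * cos (2*pi*real n*u)) has_integral
      (2 * harm (2*n) - harm n + ln (pi/2) - e)) {0..1}"
    by (intro has_integral_add has_integral_diff e has_integral_cot_gap has_integral_conjugate_kernel)
  also have "(\<lambda>u. pi/2 * cot (pi*u/2) * (1 - cos (2*pi*real n*u)) + cot_gap u
          - cot_gap u * cos (2*pi*real n*u)) = (\<lambda>u. (1 - cos (2*pi*real n*u)) / u)"
    by (rule ext) (simp add: cot_gap_def algebra_simps diff_divide_distrib)
  finally show ?thesis using that e by blast
qed

lemma Cin_LIMSEQ:
  "(\<lambda>n. integral {0..1} (\<lambda>u. (1 - cos (2*pi*real n*u)) / u) - ln (real n))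
     \<longlonglongrightarrow> euler_mascheroni + ln (2*pi)"
proof -
  let ?T = "\<lambda>n::nat. integral {0..1} (\<lambda>u. (1 - cos (2*pi*real n*u)) / u)"
  let ?em = "\<lambda>n::nat. harm n - ln (real n) :: real"
  \<comment> \<open>This is the main term minus log n: after log (2n) = log 2 + log n all log n
    cancel, leaving 2 log 2 + log (pi/2) = log (2 pi).\<close>
  let ?M = "\<lambda>n. 2 * ?em (2*n) - ?em n + 2 * ln 2 + ln (pi/2)"
  have "(\<lambda>n. ?em (2*n)) \<longlonglongrightarrow> euler_mascheroni"
    by (rule filterlim_compose[OF euler_mascheroni_LIMSEQ])
       (auto intro!: filterlim_subseq simp: strict_mono_def)
  then have "?M \<longlonglongrightarrow> 2 * euler_mascheroni - euler_mascheroni + 2 * ln 2 + ln (pi/2)"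
    by (intro tendsto_intros euler_mascheroni_LIMSEQ)
  also have "2 * euler_mascheroni - euler_mascheroni + 2 * ln 2 + ln (pi/2) =
      (euler_mascheroni + ln (2*pi) :: real)"
    by (simp add: ln_div ln_mult)
  finally have M: "?M \<longlonglongrightarrow> euler_mascheroni + ln (2*pi)" .
  have "\<bar>(?T n - ln (real n)) - ?M n\<bar> \<le> 1 / real n" if n: "n > 0" for n
  proof -
    obtain e where "((\<lambda>u. (1 - cos (2*pi*real n*u)) / u) has_integral
      (2 * harm (2*n) - harm n + ln (pi/2) - e)) {0..1}" "\<bar>e\<bar> \<le> 1 / real n"
      using has_integral_scaled_Cin[OF n] .
    then show ?thesis
      using n by (simp add: integral_unique ln_mult)
  qed
  then have "eventually (\<lambda>n. norm ((?T n - ln (real n)) - ?M n) \<le> 1 / real n) sequentially"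
    by (intro eventually_mono[OF eventually_gt_at_top[of 0]]) (simp only: real_norm_def)
  then have "(\<lambda>n. (?T n - ln (real n)) - ?M n) \<longlonglongrightarrow> 0"
    by (rule Lim_null_comparison) (rule lim_1_over_n)
  from tendsto_add[OF this M] show ?thesis by simp
qed

text \<open>Substituting x = n u stretches the integral to [0,n]. Cutting at the integers and
  shifting each piece back to [0,1] changes only the denominator, since the cosine has period
  1.\<close>

lemma integral_unwrapped_Cin:
  "((\<lambda>x. \<Sum>k<n. (1 - cos (2*pi*x)) / (x + real k)) has_integral
     integral {0..1} (\<lambda>u. (1 - cos (2*pi*real n*u)) / u)) {0..1}"
proof -
  define c where "c = (\<lambda>x::real. (1 - cos (2*pi*x)) / x)"
  define T where "T = (\<lambda>n::nat. integral {0..1} (\<lambda>u. (1 - cos (2*pi*real n*u)) / u))"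
  have c: "(c has_integral T n) {0..real n}" for n
  proof (cases "n = 0")
    case False
    have "(\<lambda>u. (1 - cos (2*pi*real n*u)) / u) integrable_on {0..1}"
      using has_integral_scaled_Cin[of n] False by (auto simp: integrable_on_def)
    then have "((\<lambda>u. (1 - cos (2*pi*real n*u)) / u) has_integral T n) (cbox 0 1)"
      unfolding T_def by (simp add: integrable_integral)
    from has_integral_affinity'[OF this, of "1/real n" 0] False
    have "((\<lambda>x. (1 - cos (2*pi*real n*(1/real n*x))) / (1/real n*x)) has_integral
        T n * real n) {0..real n}"
      by (simp add: mult.commute[of "T n"])
    from has_integral_mult_right[OF this, of "1/real n"] False
    have "((\<lambda>x. 1/real n * ((1 - cos (2*pi*real n*(1/real n*x))) / (1/real n*x))) has_integral T n)
        {0..real n}"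
      by simp
    also have "(\<lambda>x. 1/real n * ((1 - cos (2*pi*real n*(1/real n*x))) / (1/real n*x))) = c"
      using False by (simp add: c_def fun_eq_iff mult.assoc)
    finally show ?thesis .
  qed (auto simp: T_def)
  \<comment> \<open>The piece over [k, k+1] is a difference of consecutive values of
    \<open>T\<close>, so the sum over k telescopes, with \<open>T 0 = 0\<close>.\<close>
  have "((\<lambda>x. (1 - cos (2*pi*x)) / (x + real k)) has_integral (T (Suc k) - T k)) {0..1}" for k
  proof -
    have "c integrable_on {real k..real (Suc k)}"
      by (rule integrable_on_subinterval[OF has_integral_integrable[OF c[of "Suc k"]]]) auto
    then have k: "(c has_integral integral {real k..real (Suc k)} c) {real k..real (Suc k)}"
      by (rule integrable_integral)
    have "(c has_integral T k + integral {real k..real (Suc k)} c) {0..real (Suc k)}"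
      by (rule has_integral_combine[OF _ _ c k]) auto
    then have "integral {real k..real (Suc k)} c = T (Suc k) - T k"
      using has_integral_unique[OF c[of "Suc k"]] by fastforce
    with k have "(c has_integral (T (Suc k) - T k)) (cbox (real k) (real (Suc k)))"
      by simp
    from has_integral_affinity'[OF this, of 1 "real k"]
    have "((\<lambda>x. c (x + real k)) has_integral (T (Suc k) - T k)) {0..1}"
      by simp
    moreover have "cos (2*pi*(x + real k)) = cos (2*pi*x)" for x
    proof -
      have "cos (2*pi*(x + real k)) = cos (2*pi*x + 2*real k*pi)"
        by (simp add: algebra_simps)
      then show ?thesis
        by (simp only: cos_add cos_2npi sin_2npi mult_1_right mult_zero_right diff_zero)
    qed
    ultimately show ?thesis
      by (simp add: c_def)
  qed
  then have "((\<lambda>x. \<Sum>k<n. (1 - cos (2*pi*x)) / (x + real k)) has_integral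
      (\<Sum>k<n. T (Suc k) - T k)) {0..1}"
    by (intro has_integral_sum) auto
  also have "(\<Sum>k<n. T (Suc k) - T k) = T n"
    using sum_lessThan_telescope[of T n] by (simp add: T_def)
  finally show ?thesis
    by (simp add: T_def)
qed

section \<open>Continuity and integrability of log Gamma on the unit interval\<close>

lemma Gamma_real_neq_0 [simp]: "x > 0 \<Longrightarrow> Gamma x \<noteq> (0::real)"
  using Gamma_real_pos[of x] by linarith

text \<open>Also true at the pole \<open>x = 0\<close>, where \<open>Gamma 0 = 0\<close> and \<open>ln 0 = 0\<close>.\<close>

lemma ln_Gamma_plus1:
  fixes x :: real
  assumes "x \<ge> 0"
  shows "ln (Gamma x) = ln (Gamma (x + 1)) - ln x"
proof (cases "x = 0")
  case False
  with assms have x: "x > 0" by simp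
  then have "x \<notin> \<int>\<^sub>\<le>\<^sub>0" by auto
  from Gamma_plus1[OF this] x show ?thesis
    by (simp add: ln_mult)
qed simp

lemma DERIV_ln_Gamma:
  fixes x :: real
  assumes "x > 0"
  shows "((\<lambda>x. ln (Gamma x)) has_real_derivative Digamma x) (at x)"
proof -
  have "x \<notin> \<int>\<^sub>\<le>\<^sub>0" "Gamma x > 0" using assms by auto
  then show ?thesis
    by (auto intro!: derivative_eq_intros)
qed

lemma isCont_ln_Gamma:
  "x > 0 \<Longrightarrow> isCont (\<lambda>x::real. ln (Gamma x)) x"
  using DERIV_ln_Gamma DERIV_isCont by blast

text \<open>Writing log Gamma(x) = log Gamma(x+1) - log x isolates the singularity at 0 in log x,
  which the last hypothesis on \<open>w\<close> controls. The limit 0 agrees with the value there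
  because \<open>ln (Gamma 0) = 0\<close>.\<close>

lemma continuous_on_ln_Gamma_times:
  fixes w :: "real \<Rightarrow> real"
  assumes "\<And>x. isCont w x" "w 0 = 0" "((\<lambda>x. ln x * w x) \<longlongrightarrow> 0) (at_right 0)"
  shows "continuous_on {0..1} (\<lambda>x. ln (Gamma x) * w x)"
proof (rule continuous_on_unit_interval)
  have "isCont (\<lambda>x::real. ln (Gamma (x + 1))) 0"
    by (rule isCont_o2[of 0 "\<lambda>x. x + 1" "\<lambda>x. ln (Gamma x)"]) (auto intro: isCont_ln_Gamma)
  then have "((\<lambda>x::real. ln (Gamma (x + 1)) * w x) \<longlongrightarrow> ln (Gamma (0 + 1)) * w 0) (at 0)"
    using assms(1) unfolding isCont_def by (intro tendsto_mult) auto
  then have "((\<lambda>x::real. ln (Gamma (x + 1)) * w x) \<longlongrightarrow> 0) (at_right 0)"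
    using assms(2) by (auto intro: filterlim_mono[OF _ order.refl at_le])
  from tendsto_diff[OF this assms(3)]
  have "((\<lambda>x. ln (Gamma (x + 1)) * w x - ln x * w x) \<longlongrightarrow> 0) (at_right 0)"
    by simp
  then have "((\<lambda>x. ln (Gamma x) * w x) \<longlongrightarrow> 0) (at_right 0)"
  proof (rule Lim_transform_eventually)
    have "ln (Gamma (x + 1)) * w x - ln x * w x = ln (Gamma x) * w x" if "x > 0" for x
      using ln_Gamma_plus1[of x] that by (simp add: left_diff_distrib)
    then show "eventually (\<lambda>x. ln (Gamma (x + 1)) * w x - ln x * w x = ln (Gamma x) * w x) (at_right 0)"
      by (rule eventually_at_rightI[of 0 1]) auto
  qed
  then show "((\<lambda>x. ln (Gamma x) * w x) \<longlongrightarrow> ln (Gamma 0) * w 0) (at_right 0)"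
    by simp
qed (intro continuous_mult isCont_ln_Gamma assms(1))

text \<open>On the unit interval \<open>- ln x\<close> is nonnegative (also at 0, where it is 0), so
  its integrability is already absolute.\<close>

lemma absolutely_integrable_ln: "(ln :: real \<Rightarrow> real) absolutely_integrable_on {0..1}"
proof -
  define F where "F = (\<lambda>x::real. x - x * ln x)"
  have "((\<lambda>x. - ln x) has_integral (F 1 - F 0)) {0..1}"
  proof (rule integral_by_antiderivative)
    show "continuous_on {0..1} F"
    proof (rule continuous_on_unit_interval)
      have "((\<lambda>x::real. x - x * ln x) \<longlongrightarrow> 0) (at_right 0)"
        by real_asymp
      then show "(F \<longlongrightarrow> F 0) (at_right 0)" by (simp add: F_def)
    qed (auto simp: F_def intro!: continuous_intros)
  qed (auto simp: F_def intro!: derivative_eq_intros)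
  then have "(\<lambda>x::real. - ln x) absolutely_integrable_on {0..1}"
    by (intro nonnegative_absolutely_integrable_1)
       (auto simp: integrable_on_def ln_le_zero_iff le_less)
  from absolutely_integrable_scaleR_left[OF this, of "-1"] show ?thesis by simp
qed

text \<open>Log Gamma is a continuous function minus log x. Absolute integrability is the form that
  survives multiplication by bounded measurable weights.\<close>

lemma absolutely_integrable_ln_Gamma:
  "(\<lambda>x::real. ln (Gamma x)) absolutely_integrable_on {0..1}"
proof -
  have "(\<lambda>x::real. ln (Gamma (x + 1)) - ln x) absolutely_integrable_on {0..1}"
  proof (intro set_integral_diff absolutely_integrable_ln absolutely_integrable_continuous_real
      continuous_at_imp_continuous_on ballI)
    fix x :: real assume "x \<in> {0..1}"
    then show "isCont (\<lambda>x. ln (Gamma (x + 1))) x"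
      by (intro isCont_o2[of x "\<lambda>x. x + 1" "\<lambda>x. ln (Gamma x)"] isCont_ln_Gamma) auto
  qed
  then show ?thesis
  proof (rule absolutely_integrable_spike[where S = "{}"])
    show "ln (Gamma x) = ln (Gamma (x + 1)) - ln x" if "x \<in> {0..1} - {}" for x :: real
      using that by (intro ln_Gamma_plus1) simp
  qed simp
qed

lemma integrable_ln_Gamma_times:
  fixes g :: "real \<Rightarrow> real"
  assumes g: "continuous_on {0..1} g"
  shows "(\<lambda>x. ln (Gamma x) * g x) integrable_on {0..1}"
proof -
  have "(\<lambda>x. g x * ln (Gamma x)) absolutely_integrable_on {0..1}"
  proof (rule absolutely_integrable_bounded_measurable_product_real)
    show "g \<in> borel_measurable (lebesgue_on {0..1})"
      by (rule continuous_imp_measurable_on_sets_lebesgue[OF g]) auto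
    show "bounded (g ` {0..1})"
      by (intro compact_imp_bounded compact_continuous_image g) auto
  qed (auto intro: absolutely_integrable_ln_Gamma)
  then show ?thesis
    by (simp add: mult.commute absolutely_integrable_on_def)
qed

lemma has_integral_unit_reflect:
  fixes f :: "real \<Rightarrow> real"
  assumes "(f has_integral i) {0..1}"
  shows "((\<lambda>x. f (1 - x)) has_integral i) {0..1}"
proof -
  have "(\<lambda>x. 1 - x) ` {0..1} = {0..1::real}"
    by (auto simp: image_iff intro!: bexI[of _ "1 - _"])
  with has_integral_affinity[of f i 0 1 "-1" 1] assms show ?thesis
    by (simp add: algebra_simps)
qed

section \<open>The first sine coefficient of log Gamma\<close>

text \<open>Monotone convergence for the limit formula of psi, multiplied by the nonnegative factor
  1 - cos (2 pi x), whose double zero at 0 absorbs the simple pole.\<close>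

lemma has_integral_Digamma_times_one_minus_cos:
  "((\<lambda>x. Digamma x * (1 - cos (2*pi*x))) has_integral (- euler_mascheroni - ln (2*pi))) {0..1}"
proof -
  define T where "T = (\<lambda>n::nat. integral {0..1} (\<lambda>u. (1 - cos (2*pi*real n*u)) / u))"
  \<comment> \<open>The logarithm lags one behind the number m+2 of summands. This makes
    \<open>f\<close> increasing in m, since log ((m+2)/(m+1)) \<ge> 1/(m+2) \<ge> 1/(x+m+2); with
    log (m+2) instead, monotonicity would fail near x = 0. The limit is unaffected.\<close>
  define f where "f = (\<lambda>m x. ln (real m + 1) * (1 - cos (2*pi*x))
     - (\<Sum>k<m+2. (1 - cos (2*pi*x)) / (x + real k)))"
  have "((\<lambda>x. 1 - cos (2*pi*x)) has_integral (1 - sin (2*pi*1) / (2*pi) - (0 - sin (2*pi*0) / (2*pi)))) {0..1}"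
    by (rule integral_by_antiderivative)
       (auto intro!: derivative_eq_intros continuous_intros)
  then have "((\<lambda>x. 1 - cos (2*pi*x)) has_integral 1) {0..1}"
    by simp
  from has_integral_mult_right[OF this]
  have f: "(f m has_integral (ln (real m + 1) - T (m+2))) {0..1}" for m
    unfolding f_def T_def
    by (intro has_integral_diff integral_unwrapped_Cin) (metis mult.right_neutral)
  have "(\<lambda>m. (ln (real m + 1) - ln (real m + 2)) - (T (m+2) - ln (real (m+2))))
     \<longlonglongrightarrow> 0 - (euler_mascheroni + ln (2*pi))"
  proof (rule tendsto_diff)
    show "(\<lambda>m. ln (real m + 1) - ln (real m + 2)) \<longlonglongrightarrow> 0"
      by real_asymp
    show "(\<lambda>m. T (m+2) - ln (real (m+2))) \<longlonglongrightarrow> euler_mascheroni + ln (2*pi)"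
      using Cin_LIMSEQ unfolding T_def by (rule LIMSEQ_ignore_initial_segment)
  qed
  then have lim: "(\<lambda>m. integral {0..1} (f m)) \<longlonglongrightarrow> - euler_mascheroni - ln (2*pi)"
    by (simp add: integral_unique[OF f] add_ac)
  have "(\<lambda>x. Digamma x * (1 - cos (2*pi*x))) integrable_on {0..1} \<and>
     (\<lambda>m. integral {0..1} (f m)) \<longlonglongrightarrow> integral {0..1} (\<lambda>x. Digamma x * (1 - cos (2*pi*x)))"
  proof (rule monotone_convergence_increasing)
    show "f m integrable_on {0..1}" for m
      using f by (auto simp: integrable_on_def)
    show "bounded (range (\<lambda>m. integral {0..1} (f m)))"
      using lim by (rule convergent_imp_bounded)
  next
    fix m x assume x: "x \<in> {0..1::real}"
    have "ln ((real m + 1) / (real m + 2)) \<le> (real m + 1) / (real m + 2) - 1"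
      by (rule ln_le_minus_one) auto
    also have "\<dots> = - (1 / (real m + 2))"
      by (simp add: field_simps)
    also have "\<dots> \<le> - (1 / (x + real (m+2)))"
      using x by (simp add: frac_le)
    finally have "1 / (x + real (m+2)) \<le> ln (real m + 2) - ln (real m + 1)"
      by (simp add: ln_div)
    then have "(1 - cos (2*pi*x)) * (1 / (x + real (m+2))) \<le>
        (1 - cos (2*pi*x)) * (ln (real m + 2) - ln (real m + 1))"
      by (intro mult_left_mono) auto
    then show "f m x \<le> f (Suc m) x"
      by (simp add: f_def algebra_simps)
  next
    fix x assume "x \<in> {0..1::real}"
    show "(\<lambda>m. f m x) \<longlonglongrightarrow> Digamma x * (1 - cos (2*pi*x))"
    \<comment> \<open>At 0 the factor 1 - cos vanishes, so both sides are 0 whatever value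
      \<open>Digamma 0\<close> has.\<close>
    proof (cases "x = 0")
      case False
      have "(\<lambda>m. ln (real (m+2)) - (\<Sum>k<m+2. inverse (x + real k))) \<longlonglongrightarrow> Digamma x"
        using LIMSEQ_ignore_initial_segment[OF Digamma_LIMSEQ[OF False], of 2] by simp
      moreover have "(\<lambda>m. ln (real m + 1) - ln (real m + 2)) \<longlonglongrightarrow> 0"
        by real_asymp
      ultimately have "(\<lambda>m. ((ln (real (m+2)) - (\<Sum>k<m+2. inverse (x + real k))) +
          (ln (real m + 1) - ln (real m + 2))) * (1 - cos (2*pi*x)))
          \<longlonglongrightarrow> (Digamma x + 0) * (1 - cos (2*pi*x))"
        by (intro tendsto_intros)
      also have "(\<lambda>m. ((ln (real (m+2)) - (\<Sum>k<m+2. inverse (x + real k))) +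
          (ln (real m + 1) - ln (real m + 2))) * (1 - cos (2*pi*x))) = (\<lambda>m. f m x)"
      proof
        fix m
        have "(\<Sum>k<m+2. (1 - cos (2*pi*x)) / (x + real k)) =
            (1 - cos (2*pi*x)) * (\<Sum>k<m+2. inverse (x + real k))"
          by (simp only: sum_distrib_left divide_inverse)
        then show "((ln (real (m+2)) - (\<Sum>k<m+2. inverse (x + real k))) +
          (ln (real m + 1) - ln (real m + 2))) * (1 - cos (2*pi*x)) = f m x"
          unfolding f_def by (simp only:) (simp add: algebra_simps)
      qed
      finally show ?thesis by simp
    qed (simp add: f_def)
  qed
  with LIMSEQ_unique[OF lim] show ?thesis
    by (auto simp: has_integral_iff)
qed

text \<open>Integration by parts. The primitive of the sine is normalised as a multiple of 1 - cos
  (2 pi x), so the product \<open>F\<close> is continuous at 0 and both boundary values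
  vanish.\<close>

lemma has_integral_ln_Gamma_times_sin:
  "((\<lambda>x. ln (Gamma x) * sin (2*pi*x)) has_integral ((euler_mascheroni + ln (2*pi)) / (2*pi))) {0..1}"
proof -
  define F where "F = (\<lambda>x. ln (Gamma x) * (1 - cos (2*pi*x)))"
  have "((\<lambda>x. Digamma x * (1 - cos (2*pi*x)) + 2*pi * (ln (Gamma x) * sin (2*pi*x))) has_integral
      (F 1 - F 0)) {0..1}"
  proof (rule integral_by_antiderivative)
    show "continuous_on {0..1} F"
      unfolding F_def
      by (rule continuous_on_ln_Gamma_times) (simp, simp, real_asymp)
    show "(F has_real_derivative
        (Digamma x * (1 - cos (2*pi*x)) + 2*pi * (ln (Gamma x) * sin (2*pi*x)))) (at x)" if "0 < x" for x
      unfolding F_def using that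
      by (auto intro!: derivative_eq_intros DERIV_ln_Gamma)
  qed simp
  then have "((\<lambda>x. Digamma x * (1 - cos (2*pi*x)) + 2*pi * (ln (Gamma x) * sin (2*pi*x))) has_integral 0) {0..1}"
    by (simp add: F_def)
  from has_integral_diff[OF this has_integral_Digamma_times_one_minus_cos]
  have "((\<lambda>x. 2*pi * (ln (Gamma x) * sin (2*pi*x))) has_integral (euler_mascheroni + ln (2*pi))) {0..1}"
    by (simp add: add.commute)
  from has_integral_mult_right[OF this, of "1/(2*pi)"] show ?thesis
    by simp
qed

section \<open>Reflection, duplication and Raabe's integral\<close>

lemma ln_Gamma_reflection:
  fixes x :: real
  assumes "0 < x" "x < 1"
  shows "ln (Gamma x) + ln (Gamma (1 - x)) = ln pi - ln (sin (pi * x))"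
proof -
  have "pi * x < pi * 1" using assms by (intro mult_strict_left_mono) auto
  then have s: "sin (pi * x) > 0" using assms by (intro sin_gt_zero) auto
  have "complex_of_real (Gamma x * Gamma (1 - x)) = complex_of_real (pi / sin (pi * x))"
    using Gamma_reflection_complex[of "of_real x"]
    by (simp flip: Gamma_complex_of_real sin_of_real)
  then have "Gamma x * Gamma (1 - x) = pi / sin (pi * x)"
    by (simp only: of_real_eq_iff)
  then have "ln (Gamma x * Gamma (1 - x)) = ln (pi / sin (pi * x))"
    by simp
  then show ?thesis
    using assms s by (simp add: ln_mult ln_div)
qed

lemma ln_Gamma_duplication:
  fixes x :: real
  assumes "0 < x"
  shows "ln (Gamma x) + ln (Gamma (x + 1/2)) = (1 - 2*x) * ln 2 + ln pi / 2 + ln (Gamma (2*x))"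
proof -
  have n: "x \<notin> \<int>\<^sub>\<le>\<^sub>0" "x + 1/2 \<notin> \<int>\<^sub>\<le>\<^sub>0" using assms by (auto dest: nonpos_Ints_nonpos)
  have "complex_of_real (Gamma x * Gamma (x + 1/2)) =
     complex_of_real (exp ((1 - 2*x) * ln 2) * sqrt pi * Gamma (2*x))"
    using Gamma_legendre_duplication[of "of_real x"] n of_real_in_nonpos_Ints_iff[of x, where 'a=complex]
      of_real_in_nonpos_Ints_iff[of "x+1/2", where 'a=complex]
    by (simp flip: Gamma_complex_of_real exp_of_real)
  then have "Gamma x * Gamma (x + 1/2) = exp ((1 - 2*x) * ln 2) * sqrt pi * Gamma (2*x)"
    by (simp only: of_real_eq_iff)
  then have "ln (Gamma x * Gamma (x + 1/2)) = ln (exp ((1 - 2*x) * ln 2) * sqrt pi * Gamma (2*x))"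
    by simp
  then show ?thesis
    using assms by (simp add: ln_mult ln_sqrt)
qed

text \<open>Let R be the integral. Integrating the logarithmic duplication formula over [0,1/2], the
  left side covers both halves of [0,1] and gives R, while log Gamma(2x) gives R/2. The resulting
  linear equation determines R.\<close>

lemma has_integral_ln_Gamma: "((\<lambda>x::real. ln (Gamma x)) has_integral (ln (2*pi) / 2)) {0..1}"
proof -
  define R where "R = integral {0..1} (\<lambda>x::real. ln (Gamma x))"
  define P where "P = integral {0..1/2} (\<lambda>x::real. ln (Gamma x))"
  define Q where "Q = integral {1/2..1} (\<lambda>x::real. ln (Gamma x))"
  have int: "(\<lambda>x::real. ln (Gamma x)) integrable_on {0..1}"
    using absolutely_integrable_ln_Gamma by (simp add: absolutely_integrable_on_def)
  then have R: "((\<lambda>x::real. ln (Gamma x)) has_integral R) (cbox 0 1)"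
    unfolding R_def by (simp add: integrable_integral)
  have P: "((\<lambda>x::real. ln (Gamma x)) has_integral P) {0..1/2}"
    unfolding P_def by (intro integrable_integral integrable_on_subinterval[OF int]) auto
  have Q: "((\<lambda>x::real. ln (Gamma x)) has_integral Q) (cbox (1/2) 1)"
    unfolding Q_def box_real by (intro integrable_integral integrable_on_subinterval[OF int]) auto
  have PQ: "R = P + Q"
    unfolding P_def Q_def R_def
    by (subst Henstock_Kurzweil_Integration.integral_combine[OF _ _ int]) auto
  have Q': "((\<lambda>x::real. ln (Gamma (x + 1/2))) has_integral Q) {0..1/2}"
    using has_integral_affinity'[OF Q, of 1 "1/2"] by simp
  have R': "((\<lambda>x::real. ln (Gamma (2*x))) has_integral (R/2)) {0..1/2}"
    using has_integral_affinity'[OF R, of 2 0] by simp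
  define F where "F = (\<lambda>x::real. (x - x^2) * ln 2 + ln pi / 2 * x)"
  have "((\<lambda>x::real. (1 - 2*x) * ln 2 + ln pi / 2) has_integral (F (1/2) - F 0)) {0..1/2}"
    by (rule integral_by_antiderivative)
       (auto simp: F_def intro!: derivative_eq_intros continuous_intros)
  from has_integral_add[OF this R']
  have 1: "((\<lambda>x::real. (1 - 2*x) * ln 2 + ln pi / 2 + ln (Gamma (2*x))) has_integral
      (F (1/2) - F 0 + R/2)) (cbox 0 (1/2))"
    by simp
  have 2: "((\<lambda>x::real. (1 - 2*x) * ln 2 + ln pi / 2 + ln (Gamma (2*x))) has_integral
      (P + Q)) (cbox 0 (1/2))"
    using has_integral_add[OF P Q'] unfolding box_real(2)[symmetric]
    by (rule has_integral_spike_interior) (simp add: box_real ln_Gamma_duplication)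
  have "R = F (1/2) - F 0 + R/2"
    using PQ has_integral_unique[OF 1 2] by simp
  then have val: "R = ln (2*pi) / 2"
    by (simp add: F_def ln_mult power2_eq_square)
  show ?thesis using R by (simp only: val box_real)
qed

section \<open>The symmetric weight of mean zero\<close>

text \<open>The constant term \<open>1 / (2*pi)\<close> in the weight is chosen
  so that the primitive vanishes at both endpoints.\<close>

definition centred_wt_prim :: "real \<Rightarrow> real" where
  "centred_wt_prim x = (x - 1/2) * (1 - cos (2*pi*x)) / (2*pi) + sin (2*pi*x) / (4*pi^2)"

definition centred_wt :: "real \<Rightarrow> real" where
  "centred_wt x = (x - 1/2) * sin (2*pi*x) + 1 / (2*pi)"

lemma DERIV_centred_wt_prim: "(centred_wt_prim has_real_derivative centred_wt x) (at x)"
proof -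
  have d1: "((\<lambda>x. (x - 1/2) * (1 - cos (2*pi*x))) has_real_derivative
      1 - cos (2*pi*x) + (x - 1/2) * (2*pi * sin (2*pi*x))) (at x)"
    by (auto intro!: derivative_eq_intros)
  have d2: "((\<lambda>x. sin (2*pi*x)) has_real_derivative 2*pi * cos (2*pi*x)) (at x)"
    by (auto intro!: derivative_eq_intros)
  have "(centred_wt_prim has_real_derivative
      (1 - cos (2*pi*x) + (x - 1/2) * (2*pi * sin (2*pi*x))) / (2*pi) + 2*pi * cos (2*pi*x) / (4*pi^2)) (at x)"
    unfolding centred_wt_prim_def[abs_def] by (rule DERIV_add[OF DERIV_cdivide[OF d1] DERIV_cdivide[OF d2]])
  also have "(1 - cos (2*pi*x) + (x - 1/2) * (2*pi * sin (2*pi*x))) / (2*pi) + 2*pi * cos (2*pi*x) / (4*pi^2) = centred_wt x"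
    by (simp add: centred_wt_def add_divide_distrib diff_divide_distrib power2_eq_square)
  finally show ?thesis .
qed

lemma has_integral_ln_sin_times_centred_wt:
  "((\<lambda>x. ln (sin (pi * x)) * centred_wt x) has_integral 0) {0..1}"
proof -
  \<comment> \<open>Found by parts: with W = \<open>centred_wt_prim\<close>, the remaining integrand
    pi cot (pi x) W(x) equals w(x)/2 + cos (2 pi x)/(4 pi), whose primitive gives the last two
    terms.\<close>
  define F where "F = (\<lambda>x. ln (sin (pi*x)) * centred_wt_prim x - centred_wt_prim x / 2 - sin (2*pi*x) / (8*pi^2))"
  have pos: "sin (pi * x) > 0" if "0 < x" "x < 1" for x
  proof -
    have "pi * x < pi * 1" using that by (intro mult_strict_left_mono) auto
    then show ?thesis using that by (intro sin_gt_zero) auto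
  qed
  have D: "(F has_real_derivative ln (sin (pi * x)) * centred_wt x) (at x)" if x: "0 < x" "x < 1" for x
  proof -
    have d1: "((\<lambda>x. ln (sin (pi*x))) has_real_derivative pi * cos (pi*x) / sin (pi*x)) (at x)"
      using pos[OF x] by (auto intro!: derivative_eq_intros)
    have d2: "((\<lambda>x. sin (2*pi*x)) has_real_derivative 2 * pi * cos (2*pi*x)) (at x)"
      by (auto intro!: derivative_eq_intros)
    have "(F has_real_derivative (pi * cos (pi*x) / sin (pi*x) * centred_wt_prim x + centred_wt x * ln (sin (pi * x))
        - centred_wt x / 2 - 2 * pi * cos (2*pi*x) / (8*pi^2))) (at x)"
      unfolding F_def
      by (rule DERIV_diff[OF DERIV_diff[OF DERIV_mult[OF d1 DERIV_centred_wt_prim] DERIV_cdivide[OF DERIV_centred_wt_prim]]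
          DERIV_cdivide[OF d2]])
    moreover have "pi * cos (pi*x) / sin (pi*x) * centred_wt_prim x = centred_wt x / 2 + 2 * pi * cos (2*pi*x) / (8*pi^2)"
    proof -
      define s d where "s = sin (pi*x)" and "d = cos (pi*x)"
      have "s > 0" using pos[OF x] by (simp add: s_def)
      have sc: "sin (2*pi*x) = 2*(s*d)" "cos (2*pi*x) = 1 - 2 * s^2"
        using sin_double[of "pi*x"] cos_double_sin[of "pi*x"]
        by (auto simp: s_def d_def mult_ac)
      have d: "d^2 = 1 - s^2"
        by (simp add: s_def d_def cos_squared_eq)
      have "pi * d / s * centred_wt_prim x = (x - 1/2) * s * d + d^2 / (2*pi)"
        using \<open>s > 0\<close> unfolding centred_wt_prim_def sc by (simp add: field_simps power2_eq_square)
      also have "\<dots> = centred_wt x / 2 + 2 * pi * cos (2*pi*x) / (8*pi^2)"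
        unfolding centred_wt_def sc d by (simp add: field_simps power2_eq_square)
      finally show ?thesis by (simp add: s_def d_def)
    qed
    ultimately show ?thesis by (simp add: mult.commute)
  qed
  have "((\<lambda>x. ln (sin (pi * x)) * centred_wt x) has_integral (F 1 - F 0)) {0..1}"
  proof (rule integral_by_antiderivative)
    \<comment> \<open>Antisymmetry about 1/2 transfers the limit at 0 to the endpoint 1.\<close>
    have F1: "F (1 - x) = - F x" for x
    proof -
      have e: "pi * (1 - x) = pi - pi * x" "2 * pi * (1 - x) = 2 * pi - 2 * pi * x"
        by (simp_all add: algebra_simps)
      show ?thesis
        unfolding F_def centred_wt_prim_def e by (simp add: sin_diff cos_diff field_simps)
    qed
    have "((\<lambda>x. ln (sin (pi*x)) * centred_wt_prim x - centred_wt_prim x / 2 - sin (2*pi*x) / (8*pi^2)) \<longlongrightarrow> 0) (at_right 0)"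
      unfolding centred_wt_prim_def by real_asymp
    then have F0: "(F \<longlongrightarrow> 0) (at_right 0)"
      by (simp add: F_def)
    have "((\<lambda>x. - F (1 - x)) \<longlongrightarrow> - 0) (at_left 1)"
      by (intro tendsto_minus filterlim_compose[OF F0]) real_asymp
    then have "(F \<longlongrightarrow> 0) (at_left 1)"
      by (simp add: F1)
    with F0 show "continuous_on {0..1} F"
    proof (intro continuous_on_IccI)
      show "F \<midarrow>x\<rightarrow> F x" if "0 < x" "x < 1" for x
        using D[OF that] DERIV_isCont isCont_def by blast
    qed (auto simp: F_def centred_wt_prim_def)
  qed (use D in auto)
  then show ?thesis by (simp add: F_def centred_wt_prim_def)
qed

text \<open>Symmetry of the weight lets the integral I be added to its reflection, so 2I contains
  log Gamma(x) + log Gamma(1-x) = log pi - log sin (pi x). Both terms integrate to 0 against the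
  weight.\<close>

lemma has_integral_ln_Gamma_times_centred_wt:
  "((\<lambda>x. ln (Gamma x) * centred_wt x) has_integral 0) {0..1}"
proof -
  define I where "I = integral {0..1} (\<lambda>x. ln (Gamma x) * centred_wt x)"
  have cont: "continuous_on {0..1} centred_wt"
    unfolding centred_wt_def[abs_def] by (intro continuous_intros)
  have I: "((\<lambda>x. ln (Gamma x) * centred_wt x) has_integral I) {0..1}"
    unfolding I_def by (intro integrable_integral integrable_ln_Gamma_times cont)
  have sym: "centred_wt (1 - x) = centred_wt x" for x
  proof -
    have "2 * pi * (1 - x) = 2 * pi - 2 * pi * x" by (simp add: algebra_simps)
    then show ?thesis by (simp add: centred_wt_def sin_diff algebra_simps)
  qed
  from has_integral_add[OF I has_integral_unit_reflect[OF I]]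
  have "((\<lambda>x. (ln (Gamma x) + ln (Gamma (1 - x))) * centred_wt x) has_integral (I + I)) {0..1}"
    by (simp add: sym algebra_simps)
  then have 1: "((\<lambda>x. (ln pi - ln (sin (pi * x))) * centred_wt x) has_integral (I + I)) (cbox 0 1)"
    unfolding box_real(2)[symmetric]
    by (rule has_integral_spike_interior) (simp add: box_real ln_Gamma_reflection)
  have "(centred_wt has_integral (centred_wt_prim 1 - centred_wt_prim 0)) {0..1}"
    by (rule integral_by_antiderivative)
       (auto intro!: DERIV_centred_wt_prim continuous_at_imp_continuous_on intro: DERIV_isCont[OF DERIV_centred_wt_prim])
  then have "(centred_wt has_integral 0) {0..1}"
    by (simp add: centred_wt_prim_def)
  from has_integral_diff[OF has_integral_mult_right[OF this, of "ln pi"] has_integral_ln_sin_times_centred_wt]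
  have "((\<lambda>x. (ln pi - ln (sin (pi * x))) * centred_wt x) has_integral 0) (cbox 0 1)"
    by (simp add: algebra_simps)
  with 1 have "I + I = 0" by (rule has_integral_unique)
  with I show ?thesis by simp
qed

theorem proposition6p2:
  "((\<lambda>x::real. x * ln (Gamma x) * sin (2 * pi * x)) has_integral
     (euler_mascheroni / (4 * pi))) {0..1}"
proof -
  \<comment> \<open>The log (2 pi) in the sine coefficient, halved, cancels exactly against Raabe's
    integral divided by 2 pi, leaving only Euler's constant.\<close>
  have "((\<lambda>x. 1/2 * (ln (Gamma x) * sin (2*pi*x)) + ln (Gamma x) * centred_wt x - 1/(2*pi) * ln (Gamma x))
     has_integral (1/2 * ((euler_mascheroni + ln (2*pi)) / (2*pi)) + 0 - 1/(2*pi) * (ln (2*pi) / 2))) {0..1}"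
    by (rule has_integral_diff[OF has_integral_add[OF
          has_integral_mult_right[OF has_integral_ln_Gamma_times_sin, of "1/2"] has_integral_ln_Gamma_times_centred_wt]
          has_integral_mult_right[OF has_integral_ln_Gamma, of "1/(2*pi)"]])
  also have "(\<lambda>x. 1/2 * (ln (Gamma x) * sin (2*pi*x)) + ln (Gamma x) * centred_wt x - 1/(2*pi) * ln (Gamma x)) =
      (\<lambda>x. x * ln (Gamma x) * sin (2*pi*x))"
  proof
    have "1/2 * (l * s) + l * ((x - 1/2) * s + q) - q * l = x * l * s" for l s x q :: real
      by (simp add: field_simps)
    then show "1/2 * (ln (Gamma x) * sin (2*pi*x)) + ln (Gamma x) * centred_wt x - 1/(2*pi) * ln (Gamma x) =
        x * ln (Gamma x) * sin (2*pi*x)" for x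
      unfolding centred_wt_def .
  qed
  also have "1/2 * ((euler_mascheroni + ln (2*pi)) / (2*pi)) + 0 - 1/(2*pi) * (ln (2*pi) / 2) =
      euler_mascheroni / (4*pi)"
    by (simp add: field_simps)
  finally show ?thesis .
qed

end
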